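(* For every positive integer $k$, the graph of a $\{1,2k\}$-leaper on a $(4k+1)\times(4k+2)$ board is Hamiltonian (has a cycle through every vertex exactly once).
   Context: For positive integers $r,s$, the graph of an $\{r,s\}$-leaper on an $m\times n$ board has vertex set $\{(x,y): 0\le x<m,\ 0\le y<n\}$ (integers), with an edge between $(x,y)$ and $(x',y')$ whenever $(x'-x,y'-y)\in\{(\pm r,\pm s),(\pm s,\pm r)\}$. *)

theory Defs
  imports Graph_Theory.Graph_Theory
begin

text \<open>Undirected simple graphs are represented, as in \<^theory>\<open>Graph_Theory.Pair_Digraph\<close>, by
  symmetric loop-free digraphs (\<^locale>\<open>pair_graph\<close>), each edge giving two opposite arcs.\<close>

definition leaper_graph :: "nat \<Rightarrow> nat \<Rightarrow> nat \<Rightarrow> nat \<Rightarrow> (int \<times> int) pair_pre_digraph" where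
  "leaper_graph r s m n =
    (let V = {(x, y). 0 \<le> x \<and> x < int m \<and> 0 \<le> y \<and> y < int n} in
     \<lparr> pverts = V,
       parcs = {((x, y), (x', y')). (x, y) \<in> V \<and> (x', y') \<in> V \<and>
         (x' - x, y' - y) \<in> {int r, - int r} \<times> {int s, - int s} \<union> {int s, - int s} \<times> {int r, - int r}} \<rparr>)"

lemma leaper_graph_simps:
  "pverts (leaper_graph r s m n) = {0..<int m} \<times> {0..<int n}"
  "((x, y), (x', y')) \<in> parcs (leaper_graph r s m n) \<longleftrightarrow>
     (x, y) \<in> pverts (leaper_graph r s m n) \<and> (x', y') \<in> pverts (leaper_graph r s m n) \<and>
     (\<bar>x' - x\<bar> = int r \<and> \<bar>y' - y\<bar> = int s \<or> \<bar>x' - x\<bar> = int s \<and> \<bar>y' - y\<bar> = int r)"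
proof -
  have abs: "a \<in> {int q, - int q} \<longleftrightarrow> \<bar>a\<bar> = int q" for a q by auto
  show "((x, y), (x', y')) \<in> parcs (leaper_graph r s m n) \<longleftrightarrow>
     (x, y) \<in> pverts (leaper_graph r s m n) \<and> (x', y') \<in> pverts (leaper_graph r s m n) \<and>
     (\<bar>x' - x\<bar> = int r \<and> \<bar>y' - y\<bar> = int s \<or> \<bar>x' - x\<bar> = int s \<and> \<bar>y' - y\<bar> = int r)"
    by (simp only: leaper_graph_def Let_def pair_pre_digraph.select_convs mem_Collect_eq
      prod.case Un_iff mem_Sigma_iff abs)
qed (simp add: leaper_graph_def Let_def set_eq_iff)

lemma pair_graph_leaper_graph:
  assumes "r > 0" "s > 0"
  shows "pair_graph (leaper_graph r s m n)"
proof -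
  let ?G = "leaper_graph r s m n"
  have sub: "parcs ?G \<subseteq> pverts ?G \<times> pverts ?G"
    by (simp add: subset_iff split_paired_All leaper_graph_simps(2))
  have finV: "finite (pverts ?G)"
    by (simp add: leaper_graph_simps(1))
  then have finA: "finite (parcs ?G)"
    using finite_subset[OF sub] by simp
  have sym: "sym (parcs ?G)"
    by (simp add: sym_def split_paired_All leaper_graph_simps(2) abs_minus_commute)
  have loop: "fst e \<noteq> snd e" if "e \<in> parcs ?G" for e
  proof -
    obtain x y x' y' where [simp]: "e = ((x, y), (x', y'))" by (metis surj_pair)
    show ?thesis using that assms by (simp add: leaper_graph_simps(2)) linarith
  qed
  show ?thesis
  proof
    fix e assume e: "e \<in> parcs ?G"
    show "fst e \<in> pverts ?G" "snd e \<in> pverts ?G" using subsetD[OF sub e] by (simp_all add: mem_Times_iff)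
    show "fst e \<noteq> snd e" by (rule loop[OF e])
  next
    show "symmetric (with_proj ?G)" using sym by (simp add: symmetric_def)
  qed (use finV finA in simp_all)
qed

text \<open>The library's notion of cycle is the directed one: it makes the first and last vertex of the
  walk coincide and all other repetitions impossible, but admits the walk \<open>u, v, u\<close> along a single
  undirected edge. The length bound excludes the latter.\<close>

definition hamiltonian_cycle :: "'a pair_pre_digraph \<Rightarrow> ('a \<times> 'a) awalk \<Rightarrow> bool" where
  "hamiltonian_cycle G p \<longleftrightarrow>
    pre_digraph.cycle (with_proj G) p \<and> length p \<ge> 3 \<and> fst ` set p = pverts G"

definition hamiltonian :: "'a pair_pre_digraph \<Rightarrow> bool" where
  "hamiltonian G \<longleftrightarrow> (\<exists>p. hamiltonian_cycle G p)"

end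

theory Submission
  imports Defs
begin

text \<open>The cycle is invariant under the reflection \<open>(x, y) \<mapsto> (x, 4k + 1 - y)\<close>: it consists of a path
  through half of the squares, from \<open>(4k, 0)\<close> to \<open>(4k - 1, 2k + 1)\<close>, and of its mirror image.
  Taken modulo \<open>2k\<close>, a move changes one coordinate by one, so the board looks locally like four
  sheets of a square grid; the half path sweeps these sheets in zigzags that are two grid rows high.
  Distinctness needs no separate argument: the path and its mirror image reach every square, and
  their total length is the number of squares.\<close>

section \<open>Lists\<close>

text \<open>Bridge from vertex lists, in which the tour is described, to the arc walks of the
  library: zipping the list with its rotation by one place yields the arcs of the closed
  walk.\<close>

lemma hamiltonian_if_closed_list:
  assumes "set vs = pverts G" "distinct vs" "length vs \<ge> 3"
    and "successively (\<lambda>u v. (u, v) \<in> parcs G) vs" "(last vs, hd vs) \<in> parcs G"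
  shows "hamiltonian G"
proof -
  \<comment> \<open>The final vertex \<open>w\<close> is kept separate from \<open>hd us\<close> so
    that the induction can drop the first vertex while \<open>w\<close> stays fixed; it becomes
    \<open>hd vs\<close> only at the end. The start \<open>u\<close> has no influence on
    \<open>awalk_verts\<close> of a nonempty walk, so it may vary.\<close>
  have walk: "pre_digraph.cas (with_proj G) (hd us) (zip us (tl us @ [w])) w \<and>
      pre_digraph.awalk_verts (with_proj G) u (zip us (tl us @ [w])) = us @ [w] \<and>
      set (zip us (tl us @ [w])) \<subseteq> parcs G"
    if "us \<noteq> []" "successively (\<lambda>u v. (u, v) \<in> parcs G) us" "(last us, w) \<in> parcs G" for us u w
    using that
  proof (induction us arbitrary: u rule: list_nonempty_induct)
    case (single x)
    then show ?case by (simp add: pre_digraph.cas.simps pre_digraph.awalk_verts.simps)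
  next
    case (cons x xs)
    obtain y ys where xs: "xs = y # ys" using cons.hyps by (cases xs) auto
    show ?case using cons.IH[of y] cons.prems
      by (auto simp: xs pre_digraph.cas.simps pre_digraph.awalk_verts.simps)
  qed
  let ?p = "zip vs (tl vs @ [hd vs])"
  have ne: "vs \<noteq> []" using assms(3) by auto
  then have len: "length (tl vs @ [hd vs]) = length vs" by simp
  have "pre_digraph.awalk (with_proj G) (hd vs) ?p (hd vs)"
    using walk[OF ne assms(4,5)] assms(1) ne by (auto simp: pre_digraph.awalk_def)
  moreover have "distinct (tl (pre_digraph.awalk_verts (with_proj G) (hd vs) ?p))"
    using walk[OF ne assms(4,5), of "hd vs"] assms(2) ne by (cases vs) auto
  moreover have "length ?p \<ge> 3" using len assms(3) by simp
  moreover have "fst ` set ?p = pverts G"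
    using assms(1) len by (metis list.set_map map_fst_zip)
  ultimately have "hamiltonian_cycle G ?p"
    unfolding hamiltonian_cycle_def pre_digraph.cycle_def using ne by (cases vs) auto
  then show ?thesis unfolding hamiltonian_def ..
qed

lemma concat_map_upt:
  assumes "\<And>i. i < n \<Longrightarrow> f i \<noteq> []" "n > 0"
  shows "concat (map f [0..<n]) \<noteq> []" "hd (concat (map f [0..<n])) = hd (f 0)"
    "last (concat (map f [0..<n])) = last (f (n - 1))"
proof -
  obtain m where n: "n = Suc m" using assms(2) by (cases n) auto
  have "[0..<n] = 0 # [1..<n]" using assms(2) by (simp add: upt_rec)
  then show "hd (concat (map f [0..<n])) = hd (f 0)" "concat (map f [0..<n]) \<noteq> []"
    using assms by auto
  show "last (concat (map f [0..<n])) = last (f (n - 1))" using assms(1) n by simp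
qed

lemma ex_less_iff_pos: "(\<exists>i. i < n) \<longleftrightarrow> 0 < n" for n :: nat
  by auto

lemma successively_concat_map_upt:
  assumes "\<And>i. i < n \<Longrightarrow> f i \<noteq> []" "\<And>i. i < n \<Longrightarrow> successively P (f i)"
    "\<And>i. Suc i < n \<Longrightarrow> P (last (f i)) (hd (f (Suc i)))"
  shows "successively P (concat (map f [0..<n]))"
  using assms
proof (induction n)
  case (Suc n)
  show ?case
  proof (cases "n = 0")
    case False
    then obtain m where m: "n = Suc m" by (cases n) auto
    have "last (concat (map f [0..<n])) = last (f m)"
      using concat_map_upt(3)[of n f] Suc.prems(1) m by simp
    then show ?thesis using Suc m by (simp add: successively_append_iff)
  qed (use Suc in simp)
qed simp

lemma length_concat_map_upt:
  assumes "\<And>i. i < n \<Longrightarrow> length (f i) = c"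
  shows "length (concat (map f [0..<n])) = n * c"
  using assms by (induction n) auto

section \<open>Reduction to half of the cycle\<close>

text \<open>Adjacency without board bounds. That the path stays on the board comes out of a counting
  argument in \<open>hamiltonian_if_half_tour\<close>.\<close>

definition leap :: "nat \<Rightarrow> int \<times> int \<Rightarrow> int \<times> int \<Rightarrow> bool" where
  "leap k u v \<longleftrightarrow> \<bar>fst v - fst u\<bar> = 1 \<and> \<bar>snd v - snd u\<bar> = 2 * int k \<or>
    \<bar>fst v - fst u\<bar> = 2 * int k \<and> \<bar>snd v - snd u\<bar> = 1"

lemma leap_Pair [simp]:
  "leap k (x, y) (x', y') \<longleftrightarrow> \<bar>x' - x\<bar> = 1 \<and> \<bar>y' - y\<bar> = 2 * int k \<or>
    \<bar>x' - x\<bar> = 2 * int k \<and> \<bar>y' - y\<bar> = 1"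
  by (simp add: leap_def)

text \<open>The endpoints are chosen so that a leap joins \<open>(4k - 1, 2k + 1)\<close> to
  \<open>(4k, 4k + 1)\<close>, the mirror image of \<open>(4k, 0)\<close>; reflecting this leap
  closes the cycle. The length is half the number of squares, and the rows up to \<open>2k\<close>
  contain exactly one square of each mirror pair.\<close>

definition half_tour :: "nat \<Rightarrow> (int \<times> int) list \<Rightarrow> bool" where
  "half_tour k h \<longleftrightarrow> h \<noteq> [] \<and> successively (leap k) h \<and>
    hd h = (4 * int k, 0) \<and> last h = (4 * int k - 1, 2 * int k + 1) \<and>
    length h = (4 * k + 1) * (2 * k + 1) \<and>
    (\<forall>x y. 0 \<le> x \<longrightarrow> x \<le> 4 * int k \<longrightarrow> 0 \<le> y \<longrightarrow> y \<le> 2 * int k \<longrightarrow>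
      (x, y) \<in> set h \<or> (x, 4 * int k + 1 - y) \<in> set h)"

lemma hamiltonian_if_half_tour:
  assumes "k > 0" "half_tour k h"
  shows "hamiltonian (leaper_graph 1 (2 * k) (4 * k + 1) (4 * k + 2))"
proof -
  let ?G = "leaper_graph 1 (2 * k) (4 * k + 1) (4 * k + 2)"
  let ?r = "\<lambda>(x, y). (x, 4 * int k + 1 - y)"
  let ?vs = "h @ map ?r h"
  have h: "h \<noteq> []" "successively (leap k) h" "hd h = (4 * int k, 0)"
      "last h = (4 * int k - 1, 2 * int k + 1)" "length h = (4 * k + 1) * (2 * k + 1)"
    using assms(2) unfolding half_tour_def by blast+
  have cover: "(x, y) \<in> set h \<or> (x, 4 * int k + 1 - y) \<in> set h"
      if "0 \<le> x" "x \<le> 4 * int k" "0 \<le> y" "y \<le> 2 * int k" for x y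
    using assms(2) that unfolding half_tour_def by blast+
  have V: "pverts ?G = {0..<int (4 * k + 1)} \<times> {0..<int (4 * k + 2)}"
    by (rule leaper_graph_simps)
  then have card_V: "card (pverts ?G) = (4 * k + 1) * (4 * k + 2)"
    by (simp only: V card_cartesian_product card_atLeastLessThan_int diff_zero nat_int)
  have len: "length ?vs = (4 * k + 1) * (4 * k + 2)"
    unfolding length_append length_map h(5) by (simp add: algebra_simps)
  have mirror: "(x, y) \<in> set ?vs \<longleftrightarrow> (x, y) \<in> set h \<or> (x, 4 * int k + 1 - y) \<in> set h" for x y
    by force
  have sub: "pverts ?G \<subseteq> set ?vs"
  proof
    fix v assume v: "v \<in> pverts ?G"
    obtain x y where xy: "v = (x, y)" by fastforce
    have b: "0 \<le> x" "x \<le> 4 * int k" "0 \<le> y" "y \<le> 4 * int k + 1"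
      using v V xy by auto
    \<comment> \<open>For a row above \<open>2k\<close> the covering property is applied to its
      mirror row.\<close>
    show "v \<in> set ?vs"
      using cover[of x y] cover[of x "4 * int k + 1 - y"] b unfolding xy mirror by fastforce
  qed
  \<comment> \<open>The list is as long as the board is large and contains the whole board. Hence it
    contains nothing outside the board, and no square twice.\<close>
  have "card (set ?vs) \<le> card (pverts ?G)"
    using card_length[of ?vs] unfolding len card_V .
  then have set_vs: "set ?vs = pverts ?G"
    using card_seteq[OF finite_set sub] by simp
  have dist: "distinct ?vs"
    by (rule card_distinct) (simp only: set_vs card_V len)
  have arc: "(u, v) \<in> parcs ?G" if "leap k u v" "u \<in> set ?vs" "v \<in> set ?vs" for u v
    using that unfolding set_vs by (cases u; cases v) (simp only: leaper_graph_simps(2) leap_Pair, simp)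
  have "leap k (?r u) (?r v) \<longleftrightarrow> leap k u v" for u v
    by (cases u; cases v) (simp add: abs_minus_commute)
  then have "successively (leap k) (map ?r h)"
    using h(2) by (simp add: successively_map)
  then have "successively (leap k) ?vs"
    using h by (simp add: successively_append_iff hd_map)
  then have succ: "successively (\<lambda>u v. (u, v) \<in> parcs ?G) ?vs"
    by (rule successively_mono) (rule arc)
  have "leap k (last ?vs) (hd ?vs)"
    using h by (simp add: last_map)
  then have close: "(last ?vs, hd ?vs) \<in> parcs ?G"
    using arc[of "last ?vs" "hd ?vs"] h(1) last_in_set[of ?vs] hd_in_set[of ?vs] by blast
  have "length ?vs \<ge> 3" using len assms(1) by simp
  then show ?thesis by (rule hamiltonian_if_closed_list[OF set_vs dist _ succ close])
qed

section \<open>The half path\<close>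

text \<open>Modulo \<open>2k\<close> a block runs through \<open>(2i, p)\<close>,
  \<open>(2i + 1, p)\<close>, \<open>(2i + 1, p - 1)\<close>, \<open>(2i + 2, p - 1)\<close>, a
  battlement on two adjacent rows. On the board every column except \<open>2k\<close> is met exactly
  once, at a height that depends only on its parity and its side of column
  \<open>2k\<close>.\<close>

definition right_zigzag :: "nat \<Rightarrow> int \<Rightarrow> (int \<times> int) list" where
  "right_zigzag k p = concat (map (\<lambda>i.
    [(2 * int i, p), (2 * int i + 1, p - 2 * int k),
     (2 * int k + 2 * int i + 1, p - 1 - 2 * int k), (2 * int k + 2 * int i + 2, p - 1)]) [0..<k])"

text \<open>The image of \<open>right_zigzag\<close> under \<open>x \<mapsto> 4k - x\<close>, except
  that the odd columns are entered by going up \<open>2k\<close> instead of down, so they lie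
  \<open>4k\<close> higher.\<close>

definition left_zigzag :: "nat \<Rightarrow> int \<Rightarrow> (int \<times> int) list" where
  "left_zigzag k p = concat (map (\<lambda>i.
    [(4 * int k - 2 * int i, p), (4 * int k - 2 * int i - 1, p + 2 * int k),
     (2 * int k - 2 * int i - 1, p + 2 * int k - 1), (2 * int k - 2 * int i - 2, p - 1)]) [0..<k])"

text \<open>A sweep through the rows congruent to -1, 0 and 1 modulo \<open>2k\<close>. The last
  block stops halfway: its other squares would be \<open>(2k, 4k)\<close>,
  \<open>(4k, 4k + 1)\<close>, \<open>(4k - 1, 2k + 1)\<close> and \<open>(4k, 1)\<close>, and these
  or their mirror images are the first two and the last two squares of the half path.\<close>

definition border_zigzag :: "nat \<Rightarrow> (int \<times> int) list" where
  "border_zigzag k = concat (map (\<lambda>i.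
    [(2 * int i, 0), (2 * int i + 1, 2 * int k), (2 * int k + 2 * int i + 1, 2 * int k - 1),
     (2 * int k + 2 * int i + 2, 4 * int k - 1), (2 * int i + 2, 4 * int k),
     (2 * int k + 2 * int i + 2, 4 * int k + 1), (2 * int k + 2 * int i + 1, 2 * int k + 1),
     (2 * int k + 2 * int i + 2, 1)]) [0..<k - 1]) @
    [(2 * int k - 2, 0), (2 * int k - 1, 2 * int k), (4 * int k - 1, 2 * int k - 1),
     (4 * int k, 4 * int k - 1)]"

text \<open>The preceding sweeps descend four rows at a time from the top and halt in column
  \<open>2k\<close>, at height \<open>2k + 1\<close> if \<open>k\<close> is even and
  \<open>2k + 3\<close> if \<open>k\<close> is odd. The two variants fill what is left in these two
  situations, using the residues -1, 0, 1 or 0, 1, 2 modulo \<open>2k\<close>, and run in opposite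
  directions.\<close>

definition middle_zigzag :: "nat \<Rightarrow> (int \<times> int) list" where
  "middle_zigzag k = concat (map (\<lambda>i. if even k then
    [(4 * int k - 2 * int i, 2 * int k), (4 * int k - 2 * int i - 1, 0),
     (2 * int k - 2 * int i - 1, 1), (2 * int k - 2 * int i - 2, 2 * int k + 1),
     (2 * int k - 2 * int i - 1, 4 * int k + 1), (4 * int k - 2 * int i - 1, 4 * int k),
     (2 * int k - 2 * int i - 1, 4 * int k - 1), (2 * int k - 2 * int i - 2, 2 * int k - 1)]
   else
    [(2 * int i, 2 * int k + 2), (2 * int i + 1, 2), (2 * int k + 2 * int i + 1, 1),
     (2 * int i + 1, 0), (2 * int i, 2 * int k), (2 * int i + 1, 4 * int k),
     (2 * int k + 2 * int i + 1, 4 * int k + 1), (2 * int k + 2 * int i + 2, 2 * int k + 1)]) [0..<k])"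

definition upper_row :: "nat \<Rightarrow> int \<Rightarrow> (int \<times> int) list" where
  "upper_row k p = (2 * int k, p) # right_zigzag k (p + 1) @ [(2 * int k, p - 1)]"

text \<open>A zigzag omits column \<open>2k\<close>, so every other one is flanked by two squares of
  that column. One flanked and one plain zigzag make a period that descends four rows; a flanked one
  remains at the end.\<close>

definition upper_rows :: "nat \<Rightarrow> nat \<Rightarrow> (int \<times> int) list" where
  "upper_rows k l = concat (map (\<lambda>t.
      upper_row k (4 * int k - 2 - 4 * int t) @ right_zigzag k (4 * int k - 4 - 4 * int t)) [0..<l]) @
    upper_row k (4 * int k - 2 - 4 * int l)"

definition lower_row :: "nat \<Rightarrow> int \<Rightarrow> (int \<times> int) list" where
  "lower_row k p =
    left_zigzag k p @ (2 * int k, p) # left_zigzag k (p - 1) @ [(2 * int k, p - 3)]"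

text \<open>The first square stands apart because it is where \<open>middle_zigzag\<close> lands;
  each \<open>lower_row\<close> then ends in column \<open>2k\<close> as well, so the walk ends at
  \<open>(2k, 2)\<close> also when \<open>n = 0\<close>.\<close>

definition lower_rows :: "nat \<Rightarrow> nat \<Rightarrow> (int \<times> int) list" where
  "lower_rows k n = (2 * int k, 4 * int n + 2) #
    concat (map (\<lambda>t. lower_row k (4 * int n + 1 - 4 * int t)) [0..<n])"

text \<open>For \<open>k = 1\<close> the truncated \<open>k div 2 - 1\<close> makes this formula meaningless; there an ad hoc path
  is used.\<close>

definition half_path :: "nat \<Rightarrow> (int \<times> int) list" where
  "half_path k = [(4 * int k, 0), (2 * int k, 1)] @ border_zigzag k @
    upper_rows k (k div 2 - 1) @ middle_zigzag k @ lower_rows k ((k - 1) div 2) @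
    [(0, 1), (2 * int k, 0), (4 * int k, 1), (4 * int k - 1, 2 * int k + 1)]"

section \<open>Endpoints, leaps and lengths of the pieces\<close>

lemma right_zigzag:
  assumes "k > 0"
  shows "right_zigzag k p \<noteq> []" "hd (right_zigzag k p) = (0, p)"
    "last (right_zigzag k p) = (4 * int k, p - 1)"
    "successively (leap k) (right_zigzag k p)" "length (right_zigzag k p) = 4 * k"
proof -
  show "right_zigzag k p \<noteq> []" "hd (right_zigzag k p) = (0, p)"
    "last (right_zigzag k p) = (4 * int k, p - 1)"
    unfolding right_zigzag_def using assms by (simp_all add: concat_map_upt ex_less_iff_pos of_nat_diff)
  show "successively (leap k) (right_zigzag k p)"
    unfolding right_zigzag_def by (rule successively_concat_map_upt) auto
  show "length (right_zigzag k p) = 4 * k"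
    unfolding right_zigzag_def by (subst length_concat_map_upt[where c = 4]) auto
qed

lemma left_zigzag:
  assumes "k > 0"
  shows "left_zigzag k p \<noteq> []" "hd (left_zigzag k p) = (4 * int k, p)"
    "last (left_zigzag k p) = (0, p - 1)"
    "successively (leap k) (left_zigzag k p)" "length (left_zigzag k p) = 4 * k"
proof -
  show "left_zigzag k p \<noteq> []" "hd (left_zigzag k p) = (4 * int k, p)"
    "last (left_zigzag k p) = (0, p - 1)"
    unfolding left_zigzag_def using assms by (simp_all add: concat_map_upt ex_less_iff_pos of_nat_diff)
  show "successively (leap k) (left_zigzag k p)"
    unfolding left_zigzag_def by (rule successively_concat_map_upt) auto
  show "length (left_zigzag k p) = 4 * k"
    unfolding left_zigzag_def by (subst length_concat_map_upt[where c = 4]) auto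
qed

lemma border_zigzag:
  assumes "k > 1"
  shows "border_zigzag k \<noteq> []" "hd (border_zigzag k) = (0, 0)"
    "last (border_zigzag k) = (4 * int k, 4 * int k - 1)"
    "successively (leap k) (border_zigzag k)" "length (border_zigzag k) = 8 * k - 4"
proof -
  show "border_zigzag k \<noteq> []" "hd (border_zigzag k) = (0, 0)"
    "last (border_zigzag k) = (4 * int k, 4 * int k - 1)"
    unfolding border_zigzag_def using assms by (simp_all add: concat_map_upt hd_append ex_less_iff_pos)
  show "successively (leap k) (border_zigzag k)"
    unfolding border_zigzag_def successively_append_iff using assms
    by (auto simp: concat_map_upt of_nat_diff intro!: successively_concat_map_upt)
  show "length (border_zigzag k) = 8 * k - 4"
    unfolding border_zigzag_def length_append
    using assms by (subst length_concat_map_upt[where c = 8]) auto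
qed

lemma middle_zigzag:
  assumes "k > 0"
  shows "middle_zigzag k \<noteq> []"
    "hd (middle_zigzag k) = (if even k then (4 * int k, 2 * int k) else (0, 2 * int k + 2))"
    "last (middle_zigzag k) = (if even k then (0, 2 * int k - 1) else (4 * int k, 2 * int k + 1))"
    "successively (leap k) (middle_zigzag k)" "length (middle_zigzag k) = 8 * k"
proof -
  show "middle_zigzag k \<noteq> []"
    "hd (middle_zigzag k) = (if even k then (4 * int k, 2 * int k) else (0, 2 * int k + 2))"
    "last (middle_zigzag k) = (if even k then (0, 2 * int k - 1) else (4 * int k, 2 * int k + 1))"
    unfolding middle_zigzag_def using assms by (simp_all add: concat_map_upt ex_less_iff_pos of_nat_diff)
  show "successively (leap k) (middle_zigzag k)"
    unfolding middle_zigzag_def by (rule successively_concat_map_upt) auto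
  show "length (middle_zigzag k) = 8 * k"
    unfolding middle_zigzag_def by (subst length_concat_map_upt[where c = 8]) auto
qed

lemma upper_row:
  assumes "k > 0"
  shows "upper_row k p \<noteq> []" "hd (upper_row k p) = (2 * int k, p)"
    "last (upper_row k p) = (2 * int k, p - 1)"
    "successively (leap k) (upper_row k p)" "length (upper_row k p) = 4 * k + 2"
  using right_zigzag[OF assms]
  by (simp_all add: upper_row_def successively_append_iff successively_Cons)

lemma upper_rows:
  assumes "k > 0"
  shows "upper_rows k l \<noteq> []" "hd (upper_rows k l) = (2 * int k, 4 * int k - 2)"
    "last (upper_rows k l) = (2 * int k, 4 * int k - 3 - 4 * int l)"
    "successively (leap k) (upper_rows k l)"
    "length (upper_rows k l) = l * (8 * k + 2) + (4 * k + 2)"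
proof -
  note * = upper_row[OF assms] right_zigzag[OF assms]
  show "upper_rows k l \<noteq> []" "last (upper_rows k l) = (2 * int k, 4 * int k - 3 - 4 * int l)"
    unfolding upper_rows_def using * by simp_all
  show "hd (upper_rows k l) = (2 * int k, 4 * int k - 2)"
    unfolding upper_rows_def using * by (cases "l = 0") (simp_all add: concat_map_upt hd_append ex_less_iff_pos)
  show "successively (leap k) (upper_rows k l)"
    unfolding upper_rows_def successively_append_iff using *
    by (auto simp: successively_append_iff concat_map_upt of_nat_diff intro!: successively_concat_map_upt)
  show "length (upper_rows k l) = l * (8 * k + 2) + (4 * k + 2)"
    unfolding upper_rows_def length_append using *
    by (subst length_concat_map_upt[where c = "8 * k + 2"]) simp_all
qed

lemma lower_row:
  assumes "k > 0"
  shows "lower_row k p \<noteq> []" "hd (lower_row k p) = (4 * int k, p)"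
    "last (lower_row k p) = (2 * int k, p - 3)"
    "successively (leap k) (lower_row k p)" "length (lower_row k p) = 8 * k + 2"
  using left_zigzag[OF assms]
  by (simp_all add: lower_row_def successively_append_iff successively_Cons)

lemma lower_rows:
  assumes "k > 0"
  shows "lower_rows k n \<noteq> []" "hd (lower_rows k n) = (2 * int k, 4 * int n + 2)"
    "last (lower_rows k n) = (2 * int k, 2)"
    "successively (leap k) (lower_rows k n)" "length (lower_rows k n) = n * (8 * k + 2) + 1"
proof -
  note * = lower_row[OF assms]
  show "lower_rows k n \<noteq> []" "hd (lower_rows k n) = (2 * int k, 4 * int n + 2)"
    unfolding lower_rows_def by simp_all
  show "last (lower_rows k n) = (2 * int k, 2)"
    unfolding lower_rows_def using * by (cases "n = 0") (simp_all add: concat_map_upt ex_less_iff_pos of_nat_diff)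
  show "successively (leap k) (lower_rows k n)"
    unfolding lower_rows_def successively_Cons using *
    by (auto simp: concat_map_upt intro!: successively_concat_map_upt)
  show "length (lower_rows k n) = n * (8 * k + 2) + 1"
    unfolding lower_rows_def using *
    by (simp, subst length_concat_map_upt[where c = "8 * k + 2"]) simp_all
qed

section \<open>Joining the pieces\<close>

lemma half_path_walk:
  assumes "k > 1"
  shows "half_path k \<noteq> []" "successively (leap k) (half_path k)" "hd (half_path k) = (4 * int k, 0)"
    "last (half_path k) = (4 * int k - 1, 2 * int k + 1)"
    "length (half_path k) = (4 * k + 1) * (2 * k + 1)"
proof -
  have k: "k > 0" using assms by simp
  note * = border_zigzag[OF assms] upper_rows[OF k] middle_zigzag[OF k] lower_rows[OF k]
  show "half_path k \<noteq> []" "hd (half_path k) = (4 * int k, 0)"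
    "last (half_path k) = (4 * int k - 1, 2 * int k + 1)"
    unfolding half_path_def by simp_all
  define l n where "l = k div 2 - 1" and "n = (k - 1) div 2"
  have parity: "even k \<and> k = 2 * l + 2 \<and> n = l \<or> odd k \<and> k = 2 * l + 3 \<and> n = l + 1"
    unfolding l_def n_def using assms by presburger
  \<comment> \<open>These equations match the heights at the two ends of
    \<open>middle_zigzag\<close>: \<open>4k - 3 - 4l\<close> is \<open>2k + 1\<close> or
    \<open>2k + 3\<close>, and \<open>4n + 2\<close> is \<open>2k - 2\<close> or
    \<open>2k\<close>.\<close>
  then have join: "even k \<and> 2 * int k = 4 * int l + 4 \<and> n = l \<or>
    odd k \<and> 2 * int k = 4 * int l + 6 \<and> n = l + 1"
    by auto
  have path: "half_path k = [(4 * int k, 0), (2 * int k, 1)] @ border_zigzag k @ upper_rows k l @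
    middle_zigzag k @ lower_rows k n @
    [(0, 1), (2 * int k, 0), (4 * int k, 1), (4 * int k - 1, 2 * int k + 1)]"
    unfolding half_path_def l_def n_def ..
  show "successively (leap k) (half_path k)"
    unfolding path successively_append_iff using join by (auto simp: * hd_append)
  \<comment> \<open>The final 6 counts the two squares in front and the four at the end. In both
    parities \<open>l + n = k - 2\<close>, so the total is
    \<open>20k + 5 + (k - 2)(8k + 2)\<close>.\<close>
  have "length (half_path k) = 8 * k - 4 + (l * (8 * k + 2) + (4 * k + 2)) + 8 * k + (n * (8 * k + 2) + 1) + 6"
    unfolding path by (simp add: *)
  then show "length (half_path k) = (4 * k + 1) * (2 * k + 1)"
    using parity by (auto simp: algebra_simps)
qed

section \<open>Covering the board\<close>

lemma in_set_concat_map_upt: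
  "i < n \<Longrightarrow> v \<in> set (f i) \<Longrightarrow> v \<in> set (concat (map f [0..<n]))"
  by auto

text \<open>Read column by column, the zigzag has one height for each of the four classes of columns
  given by parity and side; the block index is half the offset within the side.\<close>

lemma right_zigzag_mem:
  assumes "0 \<le> x" "x \<le> 4 * int k"
    "even x \<and> x < 2 * int k \<and> y = p \<or> odd x \<and> x < 2 * int k \<and> y = p - 2 * int k \<or>
     odd x \<and> 2 * int k < x \<and> y = p - 1 - 2 * int k \<or> even x \<and> 2 * int k < x \<and> y = p - 1"
  shows "(x, y) \<in> set (right_zigzag k p)"
proof -
  \<comment> \<open>The index is sought among the integers, where Presburger arithmetic finds it,
    and is then turned into a natural number.\<close>
  have "\<exists>i. 0 \<le> i \<and> i < int k \<and> (x = 2 * i \<and> y = p \<or> x = 2 * i + 1 \<and> y = p - 2 * int k \<or>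
    x = 2 * int k + 2 * i + 1 \<and> y = p - 1 - 2 * int k \<or> x = 2 * int k + 2 * i + 2 \<and> y = p - 1)"
    using assms by presburger
  then obtain i where "i < k" "x = 2 * int i \<and> y = p \<or> x = 2 * int i + 1 \<and> y = p - 2 * int k \<or>
    x = 2 * int k + 2 * int i + 1 \<and> y = p - 1 - 2 * int k \<or> x = 2 * int k + 2 * int i + 2 \<and> y = p - 1"
    by (metis nat_int_comparison(2) zero_le_imp_eq_int)
  then show ?thesis
    unfolding right_zigzag_def by (intro in_set_concat_map_upt[of i]) auto
qed

lemma left_zigzag_mem:
  assumes "0 \<le> x" "x \<le> 4 * int k"
    "even x \<and> x < 2 * int k \<and> y = p - 1 \<or> odd x \<and> x < 2 * int k \<and> y = p + 2 * int k - 1 \<or>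
     odd x \<and> 2 * int k < x \<and> y = p + 2 * int k \<or> even x \<and> 2 * int k < x \<and> y = p"
  shows "(x, y) \<in> set (left_zigzag k p)"
proof -
  have "\<exists>i. 0 \<le> i \<and> i < int k \<and> (x = 4 * int k - 2 * i \<and> y = p \<or>
    x = 4 * int k - 2 * i - 1 \<and> y = p + 2 * int k \<or>
    x = 2 * int k - 2 * i - 1 \<and> y = p + 2 * int k - 1 \<or> x = 2 * int k - 2 * i - 2 \<and> y = p - 1)"
    using assms by presburger
  then obtain i where "i < k" "x = 4 * int k - 2 * int i \<and> y = p \<or>
    x = 4 * int k - 2 * int i - 1 \<and> y = p + 2 * int k \<or>
    x = 2 * int k - 2 * int i - 1 \<and> y = p + 2 * int k - 1 \<or> x = 2 * int k - 2 * int i - 2 \<and> y = p - 1"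
    by (metis nat_int_comparison(2) zero_le_imp_eq_int)
  then show ?thesis
    unfolding left_zigzag_def by (intro in_set_concat_map_upt[of i]) auto
qed

text \<open>The strict bounds below \<open>4k - 1\<close> and \<open>4k\<close> reflect the
  shortened last block. The bound \<open>0 < x\<close> at height \<open>4k\<close> is there because
  the blocks reach that height only in the columns \<open>2i + 2\<close>.\<close>

lemma border_zigzag_mem:
  assumes "0 \<le> x" "x \<le> 4 * int k"
    "even x \<and> x < 2 * int k \<and> y = 0 \<or> even x \<and> 0 < x \<and> x < 2 * int k \<and> y = 4 * int k \<or>
     odd x \<and> x < 2 * int k \<and> y = 2 * int k \<or> odd x \<and> 2 * int k < x \<and> y = 2 * int k - 1 \<or>
     odd x \<and> 2 * int k < x \<and> x < 4 * int k - 1 \<and> y = 2 * int k + 1 \<or>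
     even x \<and> 2 * int k < x \<and> y = 4 * int k - 1 \<or>
     even x \<and> 2 * int k < x \<and> x < 4 * int k \<and> (y = 1 \<or> y = 4 * int k + 1)"
  shows "(x, y) \<in> set (border_zigzag k)"
proof -
  have "\<exists>i. 0 \<le> i \<and> i < int k - 1 \<and> (x = 2 * i \<and> y = 0 \<or> x = 2 * i + 1 \<and> y = 2 * int k \<or>
      x = 2 * int k + 2 * i + 1 \<and> (y = 2 * int k - 1 \<or> y = 2 * int k + 1) \<or>
      x = 2 * int k + 2 * i + 2 \<and> (y = 4 * int k - 1 \<or> y = 4 * int k + 1 \<or> y = 1) \<or>
      x = 2 * i + 2 \<and> y = 4 * int k) \<or>
    x = 2 * int k - 2 \<and> y = 0 \<or> x = 2 * int k - 1 \<and> y = 2 * int k \<or>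
    x = 4 * int k - 1 \<and> y = 2 * int k - 1 \<or> x = 4 * int k \<and> y = 4 * int k - 1"
    using assms by presburger
  then consider i where "0 \<le> i" "i < int k - 1" "x = 2 * i \<and> y = 0 \<or> x = 2 * i + 1 \<and> y = 2 * int k \<or>
      x = 2 * int k + 2 * i + 1 \<and> (y = 2 * int k - 1 \<or> y = 2 * int k + 1) \<or>
      x = 2 * int k + 2 * i + 2 \<and> (y = 4 * int k - 1 \<or> y = 4 * int k + 1 \<or> y = 1) \<or>
      x = 2 * i + 2 \<and> y = 4 * int k"
    | "x = 2 * int k - 2 \<and> y = 0 \<or> x = 2 * int k - 1 \<and> y = 2 * int k \<or>
      x = 4 * int k - 1 \<and> y = 2 * int k - 1 \<or> x = 4 * int k \<and> y = 4 * int k - 1"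
    by blast
  then show ?thesis
  proof cases
    case 1
    then show ?thesis
      unfolding border_zigzag_def set_append
      by (intro UnI1 in_set_concat_map_upt[of "nat i"]) auto
  next
    case 2
    then show ?thesis unfolding border_zigzag_def by auto
  qed
qed

lemma middle_zigzag_mem_even:
  assumes "even k" "0 \<le> x" "x \<le> 4 * int k"
    "even x \<and> x < 2 * int k \<and> (y = 2 * int k + 1 \<or> y = 2 * int k - 1) \<or>
     odd x \<and> x < 2 * int k \<and> (y = 1 \<or> y = 4 * int k + 1 \<or> y = 4 * int k - 1) \<or>
     odd x \<and> 2 * int k < x \<and> (y = 0 \<or> y = 4 * int k) \<or> even x \<and> 2 * int k < x \<and> y = 2 * int k"
  shows "(x, y) \<in> set (middle_zigzag k)"
proof -
  have "\<exists>i. 0 \<le> i \<and> i < int k \<and> (x = 4 * int k - 2 * i \<and> y = 2 * int k \<or>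
    x = 4 * int k - 2 * i - 1 \<and> (y = 0 \<or> y = 4 * int k) \<or>
    x = 2 * int k - 2 * i - 1 \<and> (y = 1 \<or> y = 4 * int k + 1 \<or> y = 4 * int k - 1) \<or>
    x = 2 * int k - 2 * i - 2 \<and> (y = 2 * int k + 1 \<or> y = 2 * int k - 1))"
    using assms by presburger
  then obtain i where "0 \<le> i" "i < int k" "x = 4 * int k - 2 * i \<and> y = 2 * int k \<or>
    x = 4 * int k - 2 * i - 1 \<and> (y = 0 \<or> y = 4 * int k) \<or>
    x = 2 * int k - 2 * i - 1 \<and> (y = 1 \<or> y = 4 * int k + 1 \<or> y = 4 * int k - 1) \<or>
    x = 2 * int k - 2 * i - 2 \<and> (y = 2 * int k + 1 \<or> y = 2 * int k - 1)"
    by blast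
  then show ?thesis
    unfolding middle_zigzag_def using assms(1) by (intro in_set_concat_map_upt[of "nat i"]) auto
qed

lemma middle_zigzag_mem_odd:
  assumes "odd k" "0 \<le> x" "x \<le> 4 * int k"
    "even x \<and> x < 2 * int k \<and> (y = 2 * int k + 2 \<or> y = 2 * int k) \<or>
     odd x \<and> x < 2 * int k \<and> (y = 0 \<or> y = 2 \<or> y = 4 * int k) \<or>
     odd x \<and> 2 * int k < x \<and> (y = 1 \<or> y = 4 * int k + 1) \<or> even x \<and> 2 * int k < x \<and> y = 2 * int k + 1"
  shows "(x, y) \<in> set (middle_zigzag k)"
proof -
  have "\<exists>i. 0 \<le> i \<and> i < int k \<and> (x = 2 * i \<and> (y = 2 * int k + 2 \<or> y = 2 * int k) \<or>
    x = 2 * i + 1 \<and> (y = 0 \<or> y = 2 \<or> y = 4 * int k) \<or>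
    x = 2 * int k + 2 * i + 1 \<and> (y = 1 \<or> y = 4 * int k + 1) \<or>
    x = 2 * int k + 2 * i + 2 \<and> y = 2 * int k + 1)"
    using assms by presburger
  then obtain i where "0 \<le> i" "i < int k" "x = 2 * i \<and> (y = 2 * int k + 2 \<or> y = 2 * int k) \<or>
    x = 2 * i + 1 \<and> (y = 0 \<or> y = 2 \<or> y = 4 * int k) \<or>
    x = 2 * int k + 2 * i + 1 \<and> (y = 1 \<or> y = 4 * int k + 1) \<or>
    x = 2 * int k + 2 * i + 2 \<and> y = 2 * int k + 1"
    by blast
  then show ?thesis
    unfolding middle_zigzag_def using assms(1) by (intro in_set_concat_map_upt[of "nat i"]) auto
qed

text \<open>The first part admits \<open>t = l\<close> because one \<open>upper_row\<close> follows
  the last complete period.\<close>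

lemma upper_rows_mem:
  assumes "0 \<le> t" "t \<le> int l"
  shows "set (upper_row k (4 * int k - 2 - 4 * t)) \<subseteq> set (upper_rows k l)"
    "t < int l \<Longrightarrow> set (right_zigzag k (4 * int k - 4 - 4 * t)) \<subseteq> set (upper_rows k l)"
proof -
  let ?f = "\<lambda>t. upper_row k (4 * int k - 2 - 4 * int t) @ right_zigzag k (4 * int k - 4 - 4 * int t)"
  have t: "t = int (nat t)" using assms(1) by simp
  have sub: "set (?f i) \<subseteq> set (upper_rows k l)" if "i < l" for i
    using in_set_concat_map_upt[OF that, of _ ?f] unfolding upper_rows_def set_append by blast
  show "set (right_zigzag k (4 * int k - 4 - 4 * t)) \<subseteq> set (upper_rows k l)" if "t < int l"
    using sub[of "nat t"] that t by auto
  show "set (upper_row k (4 * int k - 2 - 4 * t)) \<subseteq> set (upper_rows k l)"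
  proof (cases "t = int l")
    case True
    then show ?thesis unfolding upper_rows_def by simp
  next
    case False
    then show ?thesis using sub[of "nat t"] assms(2) t by auto
  qed
qed

lemma lower_rows_mem:
  assumes "0 \<le> t" "t < int n"
  shows "set (lower_row k (4 * int n + 1 - 4 * t)) \<subseteq> set (lower_rows k n)"
proof -
  let ?f = "\<lambda>t. lower_row k (4 * int n + 1 - 4 * int t)"
  have t: "t = int (nat t)" "nat t < n" using assms by simp_all
  show ?thesis
    using in_set_concat_map_upt[OF t(2), of _ ?f] t(1) unfolding lower_rows_def by auto
qed

text \<open>After folding the board by the reflection, \<open>upper_rows\<close> and
  \<open>lower_rows\<close> take complementary pairs of residues modulo 4 in every column. The
  heights near the ends of the range are supplied by the border, the middle and the single
  squares.\<close>

lemma half_path_cover: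
  assumes "k > 1" and x: "0 \<le> x" "x \<le> 4 * int k" and y: "0 \<le> y" "y \<le> 2 * int k"
  shows "(x, y) \<in> set (half_path k) \<or> (x, 4 * int k + 1 - y) \<in> set (half_path k)"
proof -
  define h where "h = set (half_path k)"
  define K where "K = int k"
  define L where "L = int (k div 2 - 1)"
  define N where "N = int ((k - 1) div 2)"
  define c where "c y \<longleftrightarrow> (x, y) \<in> h \<or> (x, 4 * K + 1 - y) \<in> h" for y
  note ints = K_def[symmetric] L_def[symmetric] N_def[symmetric]
  have parity: "even K \<and> K = 2 * L + 2 \<and> N = L \<and> 0 \<le> L \<or> odd K \<and> K = 2 * L + 3 \<and> N = L + 1 \<and> 0 \<le> L"
    unfolding K_def L_def N_def using assms(1) by presburger
  have sub: "set (border_zigzag k) \<subseteq> h" "set (upper_rows k (k div 2 - 1)) \<subseteq> h"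
    "set (middle_zigzag k) \<subseteq> h" "set (lower_rows k ((k - 1) div 2)) \<subseteq> h"
    unfolding h_def half_path_def by auto
  have ends: "(4 * K, 0) \<in> h" "(2 * K, 1) \<in> h" "(0, 1) \<in> h" "(2 * K, 0) \<in> h" "(4 * K, 1) \<in> h"
    "(4 * K - 1, 2 * K + 1) \<in> h" "(2 * K, 4 * N + 2) \<in> h"
    unfolding h_def half_path_def K_def N_def lower_rows_def by auto
  \<comment> \<open>The offset is a multiple \<open>s\<close> of 4 rather than \<open>4 * t\<close>,
    so that later instances such as \<open>s = y - 2\<close> need only a divisibility test and no
    existential quantifier.\<close>
  have upper: "(x, y) \<in> h" if "4 dvd s" "0 \<le> s" "s \<le> 4 * L"
    "even x \<and> x < 2 * K \<and> y = 4 * K - 1 - s \<or> odd x \<and> x < 2 * K \<and> y = 2 * K - 1 - s \<or>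
     odd x \<and> 2 * K < x \<and> y = 2 * K - 2 - s \<or> even x \<and> 2 * K < x \<and> y = 4 * K - 2 - s \<or>
     x = 2 * K \<and> (y = 4 * K - 2 - s \<or> y = 4 * K - 3 - s)" for s y
  proof -
    obtain t where t: "s = 4 * t" using \<open>4 dvd s\<close> by (elim dvdE)
    have "(x, y) \<in> set (upper_row k (4 * K - 2 - 4 * t))"
      using that(4) t right_zigzag_mem[of x k y "4 * K - 2 - 4 * t + 1"] x
      unfolding upper_row_def K_def by auto
    then show ?thesis using upper_rows_mem(1)[of t "k div 2 - 1" k] that(2,3) t sub(2) unfolding ints by auto
  qed
  have upper': "(x, y) \<in> h" if "4 dvd s" "0 \<le> s" "s < 4 * L"
    "even x \<and> x < 2 * K \<and> y = 4 * K - 4 - s \<or> odd x \<and> x < 2 * K \<and> y = 2 * K - 4 - s \<or>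
     odd x \<and> 2 * K < x \<and> y = 2 * K - 5 - s \<or> even x \<and> 2 * K < x \<and> y = 4 * K - 5 - s" for s y
  proof -
    obtain t where t: "s = 4 * t" using \<open>4 dvd s\<close> by (elim dvdE)
    have "(x, y) \<in> set (right_zigzag k (4 * K - 4 - 4 * t))"
      using that(4) t x unfolding K_def by (intro right_zigzag_mem) auto
    then show ?thesis using upper_rows_mem(2)[of t "k div 2 - 1" k] that(2,3) t sub(2) unfolding ints by auto
  qed
  have lower: "(x, y) \<in> h" if "4 dvd s" "0 \<le> s" "s < 4 * N"
    "even x \<and> x < 2 * K \<and> (y = 4 * N - s \<or> y = 4 * N - 1 - s) \<or>
     odd x \<and> x < 2 * K \<and> (y = 4 * N + 2 * K - s \<or> y = 4 * N + 2 * K - 1 - s) \<or>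
     odd x \<and> 2 * K < x \<and> (y = 4 * N + 1 + 2 * K - s \<or> y = 4 * N + 2 * K - s) \<or>
     even x \<and> 2 * K < x \<and> (y = 4 * N + 1 - s \<or> y = 4 * N - s) \<or>
     x = 2 * K \<and> (y = 4 * N + 1 - s \<or> y = 4 * N - 2 - s)" for s y
  proof -
    obtain t where t: "s = 4 * t" using \<open>4 dvd s\<close> by (elim dvdE)
    have "(x, y) \<in> set (lower_row k (4 * N + 1 - 4 * t))"
      using that(4) t left_zigzag_mem[of x k y "4 * N + 1 - 4 * t"]
        left_zigzag_mem[of x k y "4 * N + 1 - 4 * t - 1"] x
      unfolding lower_row_def ints by auto
    then show ?thesis using lower_rows_mem[of t "(k - 1) div 2" k] that(2,3) t sub(4) unfolding ints by auto
  qed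
  have border: "(x, y) \<in> h" if
    "even x \<and> x < 2 * K \<and> y = 0 \<or> even x \<and> 0 < x \<and> x < 2 * K \<and> y = 4 * K \<or>
     odd x \<and> x < 2 * K \<and> y = 2 * K \<or> odd x \<and> 2 * K < x \<and> y = 2 * K - 1 \<or>
     odd x \<and> 2 * K < x \<and> x < 4 * K - 1 \<and> y = 2 * K + 1 \<or> even x \<and> 2 * K < x \<and> y = 4 * K - 1 \<or>
     even x \<and> 2 * K < x \<and> x < 4 * K \<and> (y = 1 \<or> y = 4 * K + 1)" for y
    using border_zigzag_mem[OF x, of y] that sub(1) unfolding ints by blast
  have middle_even: "(x, y) \<in> h" if "even K"
    "even x \<and> x < 2 * K \<and> (y = 2 * K + 1 \<or> y = 2 * K - 1) \<or>
     odd x \<and> x < 2 * K \<and> (y = 1 \<or> y = 4 * K + 1 \<or> y = 4 * K - 1) \<or>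
     odd x \<and> 2 * K < x \<and> (y = 0 \<or> y = 4 * K) \<or> even x \<and> 2 * K < x \<and> y = 2 * K" for y
    using middle_zigzag_mem_even[of k x y] x that sub(3) unfolding K_def by auto
  have middle_odd: "(x, y) \<in> h" if "odd K"
    "even x \<and> x < 2 * K \<and> (y = 2 * K + 2 \<or> y = 2 * K) \<or>
     odd x \<and> x < 2 * K \<and> (y = 0 \<or> y = 2 \<or> y = 4 * K) \<or>
     odd x \<and> 2 * K < x \<and> (y = 1 \<or> y = 4 * K + 1) \<or> even x \<and> 2 * K < x \<and> y = 2 * K + 1" for y
    using middle_zigzag_mem_odd[of k x y] x that sub(3) unfolding K_def by auto
  have y': "0 \<le> y" "y \<le> 2 * K" using y unfolding K_def .
  have x': "0 \<le> x" "x \<le> 4 * K" using x unfolding K_def .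
  have c1: "c y" if "(x, y) \<in> h" for y
    using that unfolding c_def by blast
  have c2: "c y" if "(x, z) \<in> h" "z = 4 * K + 1 - y" for y z
    using that unfolding c_def by blast
  \<comment> \<open>Apart from a few exceptional columns at the edges, the heights met in a column
    depend only on its class, so each of the five classes reduces to a question about
    \<open>y\<close> alone.\<close>
  consider "even x \<and> x < 2 * K" | "odd x \<and> x < 2 * K" | "x = 2 * K" | "odd x \<and> 2 * K < x"
    | "even x \<and> 2 * K < x"
    by fastforce
  then have "c y"
  proof cases
    case 1
    have r1: "c 0"
      by (intro c1 border) (use 1 in auto)
    \<comment> \<open>The border reaches height \<open>4K\<close> only for \<open>x > 0\<close>; in
      column 0 the square \<open>(0, 1)\<close> near the end of the path takes over.\<close>
    have r2: "c 1"
    proof (cases "x = 0")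
      case True
      show ?thesis by (rule c1) (use True ends in simp)
    next
      case False
      show ?thesis by (intro c2[of "4 * K"] border) (use 1 x' False in auto)
    qed
    have r3: "c (2 + s)" if "4 dvd s" "0 \<le> s" "s \<le> 4 * L" for s
      by (intro c2[of "4 * K - 1 - s"] upper[of s]) (use that 1 in auto)
    have r4: "c (5 + s)" if "4 dvd s" "0 \<le> s" "s < 4 * L" for s
      by (intro c2[of "4 * K - 4 - s"] upper'[of s]) (use that 1 in auto)
    have r5: "c (4 * N - s)" if "4 dvd s" "0 \<le> s" "s < 4 * N" for s
      by (intro c1 lower[of s]) (use that 1 in auto)
    have r6: "c (4 * N - 1 - s)" if "4 dvd s" "0 \<le> s" "s < 4 * N" for s
      by (intro c1 lower[of s]) (use that 1 in auto)
    have r7: "c (2 * K)" if "even K"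
      by (intro c2[of "2 * K + 1"] middle_even) (use that 1 in auto)
    have r8: "c (2 * K - 1)" if "even K"
      by (intro c1 middle_even) (use that 1 in auto)
    have r9: "c (2 * K)" if "odd K"
      by (intro c1 middle_odd) (use that 1 in auto)
    have r10: "c (2 * K - 1)" if "odd K"
      by (intro c2[of "2 * K + 2"] middle_odd) (use that 1 in auto)
    \<comment> \<open>Modulo 4, the reflected upper rows give the residues 2 and 1, the lower rows 0
      and 3; the middle adds \<open>2K - 1\<close> and \<open>2K\<close>, and the first two rows are
      known already.\<close>
    have "y = 0 \<or>
      y = 1 \<or>
      4 dvd y - 2 \<and> 0 \<le> y - 2 \<and> y - 2 \<le> 4 * L \<or>
      4 dvd y - 5 \<and> 0 \<le> y - 5 \<and> y - 5 < 4 * L \<or>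
      4 dvd 4 * N - y \<and> 0 \<le> 4 * N - y \<and> 4 * N - y < 4 * N \<or>
      4 dvd 4 * N - 1 - y \<and> 0 \<le> 4 * N - 1 - y \<and> 4 * N - 1 - y < 4 * N \<or>
      even K \<and> y = 2 * K \<or>
      even K \<and> y = 2 * K - 1 \<or>
      odd K \<and> y = 2 * K \<or>
      odd K \<and> y = 2 * K - 1"
      \<comment> \<open>Each parity of \<open>K\<close> expresses \<open>K\<close> and
        \<open>N\<close> linearly through \<open>L\<close>, and Presburger arithmetic decides the
        rest.\<close>
      using parity y' by (elim disjE conjE) (hypsubst, presburger)+
    then show ?thesis
      using r1 r2 r3[of "y - 2"] r4[of "y - 5"] r5[of "4 * N - y"] r6[of "4 * N - 1 - y"] r7 r8 r9 r10
      by auto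
  next
    case 2
    have r1: "c (2 * K)"
      by (intro c1 border) (use 2 in auto)
    have r2: "c (2 * K - 1 - s)" if "4 dvd s" "0 \<le> s" "s \<le> 4 * L" for s
      by (intro c1 upper[of s]) (use that 2 in auto)
    have r3: "c (2 * K - 4 - s)" if "4 dvd s" "0 \<le> s" "s < 4 * L" for s
      by (intro c1 upper'[of s]) (use that 2 in auto)
    have r4: "c 1" if "even K"
      by (intro c1 middle_even) (use that 2 in auto)
    have r5: "c 0" if "even K"
      by (intro c2[of "4 * K + 1"] middle_even) (use that 2 in auto)
    have r6: "c 2" if "even K"
      by (intro c2[of "4 * K - 1"] middle_even) (use that 2 in auto)
    have r7: "c 0" if "odd K"
      by (intro c1 middle_odd) (use that 2 in auto)
    have r8: "c 2" if "odd K"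
      by (intro c1 middle_odd) (use that 2 in auto)
    have r9: "c 1" if "odd K"
      by (intro c2[of "4 * K"] middle_odd) (use that 2 in auto)
    have r10: "c (2 * K - 4 * N + 1 + s)" if "4 dvd s" "0 \<le> s" "s < 4 * N" for s
      by (intro c2[of "4 * N + 2 * K - s"] lower[of s]) (use that 2 in auto)
    have r11: "c (2 * K - 4 * N + 2 + s)" if "4 dvd s" "0 \<le> s" "s < 4 * N" for s
      by (intro c2[of "4 * N + 2 * K - 1 - s"] lower[of s]) (use that 2 in auto)
    \<comment> \<open>In odd columns the rows are best counted from \<open>2K\<close> downwards:
      \<open>y - 2K\<close> is 3 or 0 modulo 4 for the upper rows and 1 or 2 for the reflected lower
      ones. Here the middle supplies rows 0, 1 and 2.\<close>
    have "y = 2 * K \<or>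
      4 dvd 2 * K - 1 - y \<and> 0 \<le> 2 * K - 1 - y \<and> 2 * K - 1 - y \<le> 4 * L \<or>
      4 dvd 2 * K - 4 - y \<and> 0 \<le> 2 * K - 4 - y \<and> 2 * K - 4 - y < 4 * L \<or>
      even K \<and> y = 1 \<or>
      even K \<and> y = 0 \<or>
      even K \<and> y = 2 \<or>
      odd K \<and> y = 0 \<or>
      odd K \<and> y = 2 \<or>
      odd K \<and> y = 1 \<or>
      4 dvd y - (2 * K - 4 * N + 1) \<and> 0 \<le> y - (2 * K - 4 * N + 1) \<and> y - (2 * K - 4 * N + 1) < 4 * N \<or>
      4 dvd y - (2 * K - 4 * N + 2) \<and> 0 \<le> y - (2 * K - 4 * N + 2) \<and> y - (2 * K - 4 * N + 2) < 4 * N"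
      using parity y' by (elim disjE conjE) (hypsubst, presburger)+
    then show ?thesis
      using r1 r2[of "2 * K - 1 - y"] r3[of "2 * K - 4 - y"] r4 r5 r6 r7 r8 r9 r10[of "y - (2 * K - 4 * N + 1)"] r11[of "y - (2 * K - 4 * N + 2)"]
      by auto
  next
    case 3
    have r1: "c 0"
      by (rule c1) (use ends 3 in simp)
    have r2: "c 1"
      by (rule c1) (use ends 3 in simp)
    have r3: "c (3 + s)" if "4 dvd s" "0 \<le> s" "s \<le> 4 * L" for s
      by (intro c2[of "4 * K - 2 - s"] upper[of s]) (use that 3 in auto)
    have r4: "c (4 + s)" if "4 dvd s" "0 \<le> s" "s \<le> 4 * L" for s
      by (intro c2[of "4 * K - 3 - s"] upper[of s]) (use that 3 in auto)
    have r5: "c (4 * N + 1 - s)" if "4 dvd s" "0 \<le> s" "s < 4 * N" for s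
      by (intro c1 lower[of s]) (use that 3 in auto)
    have r6: "c (4 * N - 2 - s)" if "4 dvd s" "0 \<le> s" "s < 4 * N" for s
      by (intro c1 lower[of s]) (use that 3 in auto)
    have r7: "c (4 * N + 2)"
      by (rule c1) (use ends 3 in simp)
    have "y = 0 \<or>
      y = 1 \<or>
      4 dvd y - 3 \<and> 0 \<le> y - 3 \<and> y - 3 \<le> 4 * L \<or>
      4 dvd y - 4 \<and> 0 \<le> y - 4 \<and> y - 4 \<le> 4 * L \<or>
      4 dvd 4 * N + 1 - y \<and> 0 \<le> 4 * N + 1 - y \<and> 4 * N + 1 - y < 4 * N \<or>
      4 dvd 4 * N - 2 - y \<and> 0 \<le> 4 * N - 2 - y \<and> 4 * N - 2 - y < 4 * N \<or>
      y = 4 * N + 2"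
      using parity y' by (elim disjE conjE) (hypsubst, presburger)+
    then show ?thesis
      using r1 r2 r3[of "y - 3"] r4[of "y - 4"] r5[of "4 * N + 1 - y"] r6[of "4 * N - 2 - y"] r7
      by auto
  next
    case 4
    have r1: "c (2 * K - 1)"
      by (intro c1 border) (use 4 in auto)
    \<comment> \<open>In column \<open>4K - 1\<close> the last square of the path replaces the one
      missing from the shortened border block.\<close>
    have r2: "c (2 * K)"
    proof (cases "x = 4 * K - 1")
      case True
      show ?thesis by (rule c2[of "2 * K + 1"]) (use True ends in simp_all)
    next
      case False
      then have "x < 4 * K - 1" using 4 x' by presburger
      then show ?thesis by (intro c2[of "2 * K + 1"] border) (use 4 in auto)
    qed
    have r3: "c (2 * K - 2 - s)" if "4 dvd s" "0 \<le> s" "s \<le> 4 * L" for s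
      by (intro c1 upper[of s]) (use that 4 in auto)
    have r4: "c (2 * K - 5 - s)" if "4 dvd s" "0 \<le> s" "s < 4 * L" for s
      by (intro c1 upper'[of s]) (use that 4 in auto)
    have r5: "c 0" if "even K"
      by (intro c1 middle_even) (use that 4 in auto)
    have r6: "c 1" if "even K"
      by (intro c2[of "4 * K"] middle_even) (use that 4 in auto)
    have r7: "c 1" if "odd K"
      by (intro c1 middle_odd) (use that 4 in auto)
    have r8: "c 0" if "odd K"
      by (intro c2[of "4 * K + 1"] middle_odd) (use that 4 in auto)
    have r9: "c (2 * K - 4 * N + s)" if "4 dvd s" "0 \<le> s" "s < 4 * N" for s
      by (intro c2[of "4 * N + 1 + 2 * K - s"] lower[of s]) (use that 4 in auto)
    have r10: "c (2 * K - 4 * N + 1 + s)" if "4 dvd s" "0 \<le> s" "s < 4 * N" for s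
      by (intro c2[of "4 * N + 2 * K - s"] lower[of s]) (use that 4 in auto)
    have "y = 2 * K - 1 \<or>
      y = 2 * K \<or>
      4 dvd 2 * K - 2 - y \<and> 0 \<le> 2 * K - 2 - y \<and> 2 * K - 2 - y \<le> 4 * L \<or>
      4 dvd 2 * K - 5 - y \<and> 0 \<le> 2 * K - 5 - y \<and> 2 * K - 5 - y < 4 * L \<or>
      even K \<and> y = 0 \<or>
      even K \<and> y = 1 \<or>
      odd K \<and> y = 1 \<or>
      odd K \<and> y = 0 \<or>
      4 dvd y - (2 * K - 4 * N) \<and> 0 \<le> y - (2 * K - 4 * N) \<and> y - (2 * K - 4 * N) < 4 * N \<or>
      4 dvd y - (2 * K - 4 * N + 1) \<and> 0 \<le> y - (2 * K - 4 * N + 1) \<and> y - (2 * K - 4 * N + 1) < 4 * N"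
      using parity y' by (elim disjE conjE) (hypsubst, presburger)+
    then show ?thesis
      using r1 r2 r3[of "2 * K - 2 - y"] r4[of "2 * K - 5 - y"] r5 r6 r7 r8 r9[of "y - (2 * K - 4 * N)"] r10[of "y - (2 * K - 4 * N + 1)"]
      by auto
  next
    case 5
    have r1: "c 2"
      by (intro c2[of "4 * K - 1"] border) (use 5 in auto)
    \<comment> \<open>Column \<open>4K\<close> is again affected by the shortened border block; rows
      1 and 0 come from \<open>(4K, 1)\<close> and \<open>(4K, 0)\<close> at the ends of the
      path.\<close>
    have r2: "c 1"
    proof (cases "x = 4 * K")
      case True
      show ?thesis by (rule c1) (use True ends in simp)
    next
      case False
      show ?thesis by (intro c1 border) (use 5 x' False in auto)
    qed
    have r3: "c 0"
    proof (cases "x = 4 * K")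
      case True
      show ?thesis by (rule c1) (use True ends in simp)
    next
      case False
      show ?thesis by (intro c2[of "4 * K + 1"] border) (use 5 x' False in auto)
    qed
    have r4: "c (3 + s)" if "4 dvd s" "0 \<le> s" "s \<le> 4 * L" for s
      by (intro c2[of "4 * K - 2 - s"] upper[of s]) (use that 5 in auto)
    have r5: "c (6 + s)" if "4 dvd s" "0 \<le> s" "s < 4 * L" for s
      by (intro c2[of "4 * K - 5 - s"] upper'[of s]) (use that 5 in auto)
    have r6: "c (2 * K)" if "even K"
      by (intro c1 middle_even) (use that 5 in auto)
    have r7: "c (2 * K)" if "odd K"
      by (intro c2[of "2 * K + 1"] middle_odd) (use that 5 in auto)
    have r8: "c (4 * N + 1 - s)" if "4 dvd s" "0 \<le> s" "s < 4 * N" for s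
      by (intro c1 lower[of s]) (use that 5 in auto)
    have r9: "c (4 * N - s)" if "4 dvd s" "0 \<le> s" "s < 4 * N" for s
      by (intro c1 lower[of s]) (use that 5 in auto)
    have "y = 2 \<or>
      y = 1 \<or>
      y = 0 \<or>
      4 dvd y - 3 \<and> 0 \<le> y - 3 \<and> y - 3 \<le> 4 * L \<or>
      4 dvd y - 6 \<and> 0 \<le> y - 6 \<and> y - 6 < 4 * L \<or>
      even K \<and> y = 2 * K \<or>
      odd K \<and> y = 2 * K \<or>
      4 dvd 4 * N + 1 - y \<and> 0 \<le> 4 * N + 1 - y \<and> 4 * N + 1 - y < 4 * N \<or>
      4 dvd 4 * N - y \<and> 0 \<le> 4 * N - y \<and> 4 * N - y < 4 * N"
      using parity y' by (elim disjE conjE) (hypsubst, presburger)+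
    then show ?thesis
      using r1 r2 r3 r4[of "y - 3"] r5[of "y - 6"] r6 r7 r8[of "4 * N + 1 - y"] r9[of "4 * N - y"]
      by auto
  qed
  then show ?thesis unfolding c_def h_def K_def .
qed

section \<open>The smallest board and the conclusion\<close>

lemma half_tour_1:
  "half_tour 1 [(4, 0), (2, 1), (0, 0), (1, 2), (3, 1), (4, 3), (3, 5), (1, 4), (0, 2), (1, 0),
    (2, 2), (0, 1), (2, 0), (4, 1), (3, 3)]" (is "half_tour 1 ?h")
proof -
  \<comment> \<open>On the 5 by 6 board the fifteen listed squares represent the fifteen mirror
    pairs, which is a finite check.\<close>
  have "\<forall>x \<in> {0, 1, 2, 3, 4}. \<forall>y \<in> {0, 1, 2}. (x, y) \<in> set ?h \<or> (x, 5 - y) \<in> set ?h"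
    by simp
  moreover have "x \<in> {0, 1, 2, 3, 4}" if "0 \<le> x" "x \<le> 4" for x :: int
    using that by auto
  moreover have "y \<in> {0, 1, 2}" if "0 \<le> y" "y \<le> 2" for y :: int
    using that by auto
  ultimately have "(x, y) \<in> set ?h \<or> (x, 5 - y) \<in> set ?h"
    if "0 \<le> x" "x \<le> 4" "0 \<le> y" "y \<le> 2" for x y
    using that by blast
  then have "\<forall>x y. 0 \<le> x \<longrightarrow> x \<le> 4 * int 1 \<longrightarrow> 0 \<le> y \<longrightarrow> y \<le> 2 * int 1 \<longrightarrow>
      (x, y) \<in> set ?h \<or> (x, 4 * int 1 + 1 - y) \<in> set ?h"
    by (simp del: set_simps)
  moreover have "successively (leap 1) ?h" by simp
  ultimately show ?thesis
    unfolding half_tour_def by (intro conjI) (assumption | simp)+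
qed

theorem theorem6:
  fixes k :: nat
  assumes "k > 0"
  shows "hamiltonian (leaper_graph 1 (2 * k) (4 * k + 1) (4 * k + 2))"
proof (cases "k = 1")
  case True
  then show ?thesis using hamiltonian_if_half_tour[OF assms] half_tour_1 by blast
next
  case False
  then have "k > 1" using assms by simp
  then have "half_tour k (half_path k)"
    using half_path_walk half_path_cover unfolding half_tour_def by blast
  then show ?thesis by (rule hamiltonian_if_half_tour[OF assms])
qed

end
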